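(* If a Bayesian predictor $p_0(X)$ of $Y$ is unique, then it is admissible.
   Context: $(X,Y)$ is a random vector with values in $(F\times G,\mathcal{F}\otimes\mathcal{G})$, with $Y$ real valued. Its distribution belongs to a family $(\mathbb{P}_\theta,\theta\in\Theta)$, where $\Theta\subset\mathbb{R}$ is open and $\mathbb{P}_\theta$ has density $f(x,y,\theta)$ with respect to a $\sigma$-finite measure $\lambda\otimes\mu$. $\mathbb{E}_\theta$ denotes expectation under $\mathbb{P}_\theta$. A random variable $\mathbb{T}$ with values in $\Theta$ has prior distribution $\tau$, with density $\varphi(\theta)$ with respect to a $\sigma$-finite measure $\nu$. The joint law of $(X,Y,\mathbb{T})$ is $\mathbb{Q}$, with density $f(x,y,\theta)\varphi(\theta)$ with respect to $\lambda\otimes\mu\otimes\nu$, and $\mathbb{E}$ denotes expectation under $\mathbb{Q}$. $Y$ and the predictors are taken square integrable. A statistical predictor is a measurable real function $p(X)$ of $X$ not depending on $\theta$. The Bayesian risk of $p(X)$ is $$r(p(X),Y)=\mathbb{E}(p(X)-Y)^2=\int_\Theta \mathbb{E}_\theta(p(X)-Y)^2\varphi(\theta)\,d\nu(\theta).$$ A Bayesian predictor $p_0(X)$ is a minimizer over $p$ of $r(p(X),Y)$, namely $p_0(X)=\mathbb{E}(Y\mid X)$; it is assumed to exist. It is called unique if it differs from any other Bayesian predictor only on a set $\mathcal{N}$ with $\mathbb{P}_\theta(\mathcal{N})=0$ for all $\theta\in\Theta$. A predictor $q(X)$ is admissible if there is no predictor $p(X)$ such that $\mathbb{E}_\theta(p(X)-Y)^2\le\mathbb{E}_\theta(q(X)-Y)^2$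 for all $\theta\in\Theta$ with strict inequality for at least one $\theta$. *)

theory Defs
  imports "HOL-Probability.Probability"
begin

(* The model is canonical: X, Y and the random parameter are the coordinates of ((x, y), \<theta>).
   L is the dominating measure on F = space L (L stands for lambda, which is a reserved symbol).
   The real variable Y takes its values in G = space \<mu>, which may be any set of reals; its
   sigma-algebra only has to make the inclusion of G into the reals measurable. *)

locale bayesian_prediction =
  L: sigma_finite_measure L + \<mu>: sigma_finite_measure \<mu> + \<nu>: sigma_finite_measure \<nu>
  for L :: "'a measure" and \<mu> :: "real measure" and \<nu> :: "real measure" +
  fixes \<Theta> :: "real set"
    and f :: "'a \<Rightarrow> real \<Rightarrow> real \<Rightarrow> real"
    and \<phi> :: "real \<Rightarrow> real"
  assumes open_Theta: "open \<Theta>"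
    and space_nu: "space \<nu> = \<Theta>"
    and sets_nu: "sets \<nu> = sets (restrict_space borel \<Theta>)"
    and Y_measurable: "(\<lambda>y. y) \<in> borel_measurable \<mu>"
    and f_measurable: "(\<lambda>((x, y), \<theta>). f x y \<theta>) \<in> borel_measurable ((L \<Otimes>\<^sub>M \<mu>) \<Otimes>\<^sub>M \<nu>)"
    and f_nonneg: "\<And>x y \<theta>. x \<in> space L \<Longrightarrow> y \<in> space \<mu> \<Longrightarrow> \<theta> \<in> \<Theta> \<Longrightarrow> 0 \<le> f x y \<theta>"
    and f_prob: "\<And>\<theta>. \<theta> \<in> \<Theta> \<Longrightarrow> prob_space (density (L \<Otimes>\<^sub>M \<mu>) (\<lambda>(x, y). f x y \<theta>))"
    and prior_measurable: "\<phi> \<in> borel_measurable \<nu>"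
    and prior_nonneg: "\<And>\<theta>. \<theta> \<in> \<Theta> \<Longrightarrow> 0 \<le> \<phi> \<theta>"
    and prior_prob: "prob_space (density \<nu> \<phi>)"
    and Y_square_integrable:
      "\<And>\<theta>. \<theta> \<in> \<Theta> \<Longrightarrow>
         integrable (density (L \<Otimes>\<^sub>M \<mu>) (\<lambda>(x, y). f x y \<theta>)) (\<lambda>(x, y). y\<^sup>2)"
    and Y_square_integrable_joint:
      "integrable (density ((L \<Otimes>\<^sub>M \<mu>) \<Otimes>\<^sub>M \<nu>) (\<lambda>((x, y), \<theta>). f x y \<theta> * \<phi> \<theta>))
         (\<lambda>((x, y), \<theta>). y\<^sup>2)"
begin

definition P :: "real \<Rightarrow> ('a \<times> real) measure" where
  "P \<theta> = density (L \<Otimes>\<^sub>M \<mu>) (\<lambda>(x, y). f x y \<theta>)"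

definition Q :: "(('a \<times> real) \<times> real) measure" where
  "Q = density ((L \<Otimes>\<^sub>M \<mu>) \<Otimes>\<^sub>M \<nu>) (\<lambda>((x, y), \<theta>). f x y \<theta> * \<phi> \<theta>)"

(* Square integrability is required under every P \<theta> and under Q, so that the real-valued
   integrals in both risks below are genuine (a non-integrable function would have integral 0). *)
definition predictor :: "('a \<Rightarrow> real) \<Rightarrow> bool" where
  "predictor p \<longleftrightarrow>
     p \<in> borel_measurable L \<and>
     (\<forall>\<theta>\<in>\<Theta>. integrable (P \<theta>) (\<lambda>(x, y). (p x)\<^sup>2)) \<and>
     integrable Q (\<lambda>((x, y), \<theta>). (p x)\<^sup>2)"

definition risk :: "real \<Rightarrow> ('a \<Rightarrow> real) \<Rightarrow> real" where
  "risk \<theta> p = (\<integral>(x, y). (p x - y)\<^sup>2 \<partial>P \<theta>)"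

definition bayes_risk :: "('a \<Rightarrow> real) \<Rightarrow> real" where
  "bayes_risk p = (\<integral>((x, y), \<theta>). (p x - y)\<^sup>2 \<partial>Q)"

definition bayesian_predictor :: "('a \<Rightarrow> real) \<Rightarrow> bool" where
  "bayesian_predictor p0 \<longleftrightarrow>
     predictor p0 \<and> (\<forall>p. predictor p \<longrightarrow> bayes_risk p0 \<le> bayes_risk p)"

definition unique_bayesian_predictor :: "('a \<Rightarrow> real) \<Rightarrow> bool" where
  "unique_bayesian_predictor p0 \<longleftrightarrow>
     bayesian_predictor p0 \<and>
     (\<forall>p. bayesian_predictor p \<longrightarrow>
        (\<forall>\<theta>\<in>\<Theta>. {(x, y) \<in> space (P \<theta>). p x \<noteq> p0 x} \<in> null_sets (P \<theta>)))"

definition admissible :: "('a \<Rightarrow> real) \<Rightarrow> bool" where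
  "admissible q \<longleftrightarrow>
     predictor q \<and>
     \<not> (\<exists>p. predictor p \<and> (\<forall>\<theta>\<in>\<Theta>. risk \<theta> p \<le> risk \<theta> q) \<and> (\<exists>\<theta>\<in>\<Theta>. risk \<theta> p < risk \<theta> q))"

end

end

theory Submission
  imports Defs
begin

text \<open>
  Averaging against the prior turns domination into a comparison of Bayesian risks. All risks are
  integrals of the nonnegative function \<open>(p x - y)\<^sup>2\<close>, so Tonelli's theorem gives
  \<open>bayes_risk p = \<integral> risk \<theta> p * \<phi> \<theta> d\<nu>\<close> (\<open>ennreal_bayes_risk\<close>). If a predictor \<open>p\<close> has at most
  the risk of the Bayesian predictor \<open>p0\<close> at every \<open>\<theta>\<close>, then its Bayesian risk is at most the minimal
  one, so \<open>p\<close> is Bayesian as well. Uniqueness then says that \<open>p\<close> and \<open>p0\<close> agree almost surely under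
  every \<open>P \<theta>\<close>, including those that the prior does not see; hence they have the same risk at
  every \<open>\<theta>\<close>, and no strict inequality is possible.
\<close>

lemma integrable_power2_diff:
  fixes u v :: "'b \<Rightarrow> real"
  assumes [measurable]: "u \<in> borel_measurable M" "v \<in> borel_measurable M"
    and "integrable M (\<lambda>z. (u z)\<^sup>2)" "integrable M (\<lambda>z. (v z)\<^sup>2)"
  shows "integrable M (\<lambda>z. (u z - v z)\<^sup>2)"
proof (rule Bochner_Integration.integrable_bound)
  show "integrable M (\<lambda>z. 2 * (u z)\<^sup>2 + 2 * (v z)\<^sup>2)"
    using assms by auto
  have "(a - b)\<^sup>2 \<le> 2 * a\<^sup>2 + 2 * b\<^sup>2" for a b :: real
    using zero_le_power2[of "a + b"] by (simp add: power2_sum power2_diff)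
  then show "AE z in M. norm ((u z - v z)\<^sup>2) \<le> norm (2 * (u z)\<^sup>2 + 2 * (v z)\<^sup>2)"
    by simp
qed simp

context bayesian_prediction
begin

sublocale L\<mu>: pair_sigma_finite L \<mu> ..

sublocale L\<mu>\<nu>: pair_sigma_finite "L \<Otimes>\<^sub>M \<mu>" \<nu> ..

lemma sets_P [measurable_cong]: "sets (P \<theta>) = sets (L \<Otimes>\<^sub>M \<mu>)"
  by (simp add: P_def)

lemma sets_Q [measurable_cong]: "sets Q = sets ((L \<Otimes>\<^sub>M \<mu>) \<Otimes>\<^sub>M \<nu>)"
  by (simp add: Q_def)

lemma f_section_measurable:
  assumes "\<theta> \<in> \<Theta>"
  shows "(\<lambda>(x, y). f x y \<theta>) \<in> borel_measurable (L \<Otimes>\<^sub>M \<mu>)"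
proof -
  have "(\<lambda>z. (z, \<theta>)) \<in> measurable (L \<Otimes>\<^sub>M \<mu>) ((L \<Otimes>\<^sub>M \<mu>) \<Otimes>\<^sub>M \<nu>)"
    using assms space_nu by simp
  from measurable_comp[OF this f_measurable] show ?thesis
    by (simp add: comp_def split_beta')
qed

lemma Y_coordinate_measurable: "snd \<in> borel_measurable (L \<Otimes>\<^sub>M \<mu>)"
  using measurable_comp[OF measurable_snd Y_measurable] by (simp add: comp_def)

lemma squared_error_measurable:
  assumes "predictor p"
  shows "(\<lambda>(x, y). (p x - y)\<^sup>2) \<in> borel_measurable (L \<Otimes>\<^sub>M \<mu>)"
proof -
  have [measurable]: "p \<in> borel_measurable L"
    using assms by (simp add: predictor_def)
  note Y_coordinate_measurable [measurable]
  show ?thesis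
    unfolding split_beta' by measurable
qed

lemma ennreal_risk:
  assumes p: "predictor p" and \<theta>: "\<theta> \<in> \<Theta>"
  shows "ennreal (risk \<theta> p) = (\<integral>\<^sup>+(x, y). ennreal ((p x - y)\<^sup>2) \<partial>P \<theta>)"
proof -
  have [measurable]: "p \<in> borel_measurable L"
    using p by (simp add: predictor_def)
  note Y_coordinate_measurable [measurable]
  have "integrable (P \<theta>) (\<lambda>z. (p (fst z) - snd z)\<^sup>2)"
  proof (rule integrable_power2_diff)
    show "integrable (P \<theta>) (\<lambda>z. (p (fst z))\<^sup>2)"
      using p \<theta> by (simp add: predictor_def split_beta')
    show "integrable (P \<theta>) (\<lambda>z. (snd z)\<^sup>2)"
      using Y_square_integrable[OF \<theta>] by (simp add: P_def split_beta')
  qed measurable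
  then show ?thesis
    by (simp add: risk_def split_beta' nn_integral_eq_integral)
qed

text \<open>The factor \<open>\<phi> \<theta>\<close> of the joint density is constant in \<open>(x, y)\<close>, so integrating \<open>(x, y)\<close> out
  first, by Tonelli's theorem, leaves the pointwise risk. Stated in the extended nonnegative reals,
  the average is monotone in the risk function.\<close>

lemma ennreal_bayes_risk:
  assumes p: "predictor p"
  shows "ennreal (bayes_risk p) = (\<integral>\<^sup>+\<theta>. ennreal (risk \<theta> p) * ennreal (\<phi> \<theta>) \<partial>\<nu>)"
proof -
  have [measurable]: "p \<in> borel_measurable L"
    using p by (simp add: predictor_def)
  have [measurable]: "(\<lambda>w. f (fst (fst w)) (snd (fst w)) (snd w))
      \<in> borel_measurable ((L \<Otimes>\<^sub>M \<mu>) \<Otimes>\<^sub>M \<nu>)"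
    using f_measurable by (simp add: split_beta')
  note Y_coordinate_measurable [measurable] prior_measurable [measurable]
  let ?g = "\<lambda>z. ennreal ((p (fst z) - snd z)\<^sup>2)"
  let ?h = "\<lambda>w. ennreal (f (fst (fst w)) (snd (fst w)) (snd w) * \<phi> (snd w)) * ?g (fst w)"
  have h_measurable: "?h \<in> borel_measurable ((L \<Otimes>\<^sub>M \<mu>) \<Otimes>\<^sub>M \<nu>)"
    by measurable
  have "integrable Q (\<lambda>w. (p (fst (fst w)) - snd (fst w))\<^sup>2)"
  proof (rule integrable_power2_diff)
    show "integrable Q (\<lambda>w. (p (fst (fst w)))\<^sup>2)"
      using p by (simp add: predictor_def split_beta')
    show "integrable Q (\<lambda>w. (snd (fst w))\<^sup>2)"
      using Y_square_integrable_joint by (simp add: Q_def split_beta')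
  qed measurable
  then have "ennreal (bayes_risk p) = (\<integral>\<^sup>+w. ?g (fst w) \<partial>Q)"
    by (simp add: bayes_risk_def split_beta' nn_integral_eq_integral)
  also have "\<dots> = (\<integral>\<^sup>+w. ?h w \<partial>((L \<Otimes>\<^sub>M \<mu>) \<Otimes>\<^sub>M \<nu>))"
    unfolding Q_def split_beta' by (rule nn_integral_density) measurable
  also have "\<dots> = (\<integral>\<^sup>+\<theta>. \<integral>\<^sup>+z. ?h (z, \<theta>) \<partial>(L \<Otimes>\<^sub>M \<mu>) \<partial>\<nu>)"
    using L\<mu>\<nu>.nn_integral_snd[OF h_measurable] by simp
  also have "\<dots> = (\<integral>\<^sup>+\<theta>. ennreal (risk \<theta> p) * ennreal (\<phi> \<theta>) \<partial>\<nu>)"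
  proof (rule nn_integral_cong)
    fix \<theta> assume "\<theta> \<in> space \<nu>"
    then have \<theta>: "\<theta> \<in> \<Theta>"
      by (simp add: space_nu)
    have [measurable]: "(\<lambda>z. f (fst z) (snd z) \<theta>) \<in> borel_measurable (L \<Otimes>\<^sub>M \<mu>)"
      using f_section_measurable[OF \<theta>] by (simp add: split_beta')
    have "(\<integral>\<^sup>+z. ?h (z, \<theta>) \<partial>(L \<Otimes>\<^sub>M \<mu>))
        = (\<integral>\<^sup>+z. (ennreal (f (fst z) (snd z) \<theta>) * ?g z) * ennreal (\<phi> \<theta>) \<partial>(L \<Otimes>\<^sub>M \<mu>))"
      using f_nonneg prior_nonneg \<theta>
      by (intro nn_integral_cong) (auto simp: space_pair_measure ennreal_mult ac_simps)
    also have "\<dots> = (\<integral>\<^sup>+z. ennreal (f (fst z) (snd z) \<theta>) * ?g z \<partial>(L \<Otimes>\<^sub>M \<mu>)) * ennreal (\<phi> \<theta>)"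
      by (rule nn_integral_multc) measurable
    also have "(\<integral>\<^sup>+z. ennreal (f (fst z) (snd z) \<theta>) * ?g z \<partial>(L \<Otimes>\<^sub>M \<mu>)) = (\<integral>\<^sup>+z. ?g z \<partial>P \<theta>)"
      unfolding P_def split_beta' by (rule nn_integral_density[symmetric]) measurable
    also have "\<dots> = ennreal (risk \<theta> p)"
      using ennreal_risk[OF p \<theta>] by (simp add: split_beta')
    finally show "(\<integral>\<^sup>+z. ?h (z, \<theta>) \<partial>(L \<Otimes>\<^sub>M \<mu>)) = ennreal (risk \<theta> p) * ennreal (\<phi> \<theta>)" .
  qed
  finally show ?thesis .
qed

lemma bayes_risk_mono:
  assumes "predictor p" "predictor q" and le: "\<And>\<theta>. \<theta> \<in> \<Theta> \<Longrightarrow> risk \<theta> p \<le> risk \<theta> q"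
  shows "bayes_risk p \<le> bayes_risk q"
proof -
  have "ennreal (bayes_risk p) \<le> ennreal (bayes_risk q)"
    unfolding ennreal_bayes_risk[OF assms(1)] ennreal_bayes_risk[OF assms(2)]
    by (intro nn_integral_mono mult_right_mono ennreal_leI le) (simp_all add: space_nu)
  moreover have "0 \<le> bayes_risk q"
    by (simp add: bayes_risk_def split_beta')
  ultimately show ?thesis
    by simp
qed

lemma risk_eq_if_AE_eq:
  assumes "predictor p" "predictor q"
    and null: "{(x, y) \<in> space (P \<theta>). p x \<noteq> q x} \<in> null_sets (P \<theta>)"
  shows "risk \<theta> p = risk \<theta> q"
  unfolding risk_def
proof (rule integral_cong_AE)
  show "AE z in P \<theta>. (case z of (x, y) \<Rightarrow> (p x - y)\<^sup>2) = (case z of (x, y) \<Rightarrow> (q x - y)\<^sup>2)"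
    by (rule AE_I'[OF null]) auto
qed (use assms squared_error_measurable in \<open>simp_all add: P_def\<close>)

lemma unique_bayesian_predictor_admissible:
  assumes unique: "unique_bayesian_predictor p0"
  shows "admissible p0"
  unfolding admissible_def
proof (intro conjI notI)
  have bayes: "bayesian_predictor p0"
    using unique by (simp add: unique_bayesian_predictor_def)
  then show p0: "predictor p0"
    by (simp add: bayesian_predictor_def)
  assume "\<exists>p. predictor p \<and> (\<forall>\<theta>\<in>\<Theta>. risk \<theta> p \<le> risk \<theta> p0) \<and> (\<exists>\<theta>\<in>\<Theta>. risk \<theta> p < risk \<theta> p0)"
  then obtain p \<theta> where p: "predictor p" and le: "\<And>\<theta>. \<theta> \<in> \<Theta> \<Longrightarrow> risk \<theta> p \<le> risk \<theta> p0"
    and \<theta>: "\<theta> \<in> \<Theta>" and less: "risk \<theta> p < risk \<theta> p0"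
    by blast
  have "bayes_risk p \<le> bayes_risk p0"
    using p p0 le by (rule bayes_risk_mono)
  then have "bayesian_predictor p"
    using p bayes unfolding bayesian_predictor_def by (meson order_trans)
  then have "{(x, y) \<in> space (P \<theta>). p x \<noteq> p0 x} \<in> null_sets (P \<theta>)"
    using unique \<theta> unfolding unique_bayesian_predictor_def by blast
  then have "risk \<theta> p = risk \<theta> p0"
    by (rule risk_eq_if_AE_eq[OF p p0])
  with less show False
    by simp
qed

end

theorem proposition4p1:
  fixes L :: "'a measure" and \<mu> \<nu> :: "real measure" and \<Theta> :: "real set"
    and f :: "'a \<Rightarrow> real \<Rightarrow> real \<Rightarrow> real" and \<phi> :: "real \<Rightarrow> real" and p0 :: "'a \<Rightarrow> real"
  assumes "bayesian_prediction L \<mu> \<nu> \<Theta> f \<phi>"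
    and "bayesian_prediction.unique_bayesian_predictor L \<mu> \<nu> \<Theta> f \<phi> p0"
  shows "bayesian_prediction.admissible L \<mu> \<nu> \<Theta> f \<phi> p0"
  using assms by (rule bayesian_prediction.unique_bayesian_predictor_admissible)

end
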